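(* Let $\mathbb{X}$ be a real reflexive Banach space with dual $\mathbb{X}^*$, and let $g:\mathbb{X}\to\mathbb{R}$ be proper, convex, lower semicontinuous, uniformly Fréchet differentiable, $\gamma$-strongly convex for some $\gamma>0$, strongly coercive and Legendre. Let $\mathcal{A}:\mathbb{X}\to\mathbb{X}^*$ be monotone and Lipschitz continuous with constant $L>0$, and let $\mathcal{B}:\mathbb{X}\to 2^{\mathbb{X}^*}$ be maximal monotone. Assume that $(\mathcal{A}+\mathcal{B})^{-1}(0^* ):=\{v\in\mathbb{X}: 0^*\in \mathcal{A}v+\mathcal{B}v\}\neq\emptyset$. Let $\delta\in(0,\frac12)$ and let $\mu\in\left[\delta,\frac{\gamma(1-2\delta)}{2L}\right]$. For arbitrary $v_0,v_1\in\mathbb{X}$ define $$v_{n+1}=\mathrm{Res}^g_{\mu\mathcal{B}}\Big(\nabla g^*\big(\nabla g(v_n)-\mu(2\mathcal{A}v_n-\mathcal{A}v_{n-1})\big)\Big),\quad n\geq 1.$$ Then $\min_{1\le j\le n}\|v_{j+1}-v_j\|=\mathcal{O}(1/\sqrt{n})$ as $n\to\infty$.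
   Context: $0^*$ is the zero of $\mathbb{X}^*$. $g^*(x^* )=\sup_{x\in\mathbb{X}}\{\langle x^*,x\rangle-g(x)\}$ is the Fenchel conjugate of $g$. Conditions on $g$: $g$ is uniformly Fréchet differentiable if the limit $\langle\nabla g(x),y\rangle=\lim_{\lambda\to0}\frac{g(x+\lambda y)-g(x)}{\lambda}$ is attained uniformly for $x\in\mathbb{X}$ and $\|y\|=1$. $g$ is $\gamma$-strongly convex if $\langle\nabla g(x)-\nabla g(y),x-y\rangle\ge\gamma\|x-y\|^2$ for all $x,y$. $g$ is strongly coercive if $g(x)/\|x\|\to+\infty$ as $\|x\|\to\infty$. $g$ is Legendre if $g$ and $g^*$ are Gâteaux differentiable on the interiors of their domains, these interiors are nonempty, and the domains of $\nabla g$ and $\nabla g^*$ equal $\mathrm{int}(\mathrm{dom}\, g)$ and $\mathrm{int}(\mathrm{dom}\, g^* )$ respectively. Under these conditions $\nabla g:\mathbb{X}\to\mathbb{X}^*$ is a bijection, $\mathrm{dom}\,g^*=\mathbb{X}^*$ and $\nabla g^*=(\nabla g)^{-1}$. Resolvent: for $\mu>0$, $\mathrm{Res}^g_{\mu\mathcal{B}}:=(\nabla g+\mu\mathcal{B})^{-1}\circ\nabla g$, which is single-valued and everywhere defined for $\mathcal{B}$ maximal monotone. $\mathcal{A}$ is monotone if $\langle\mathcal{A}x-\mathcal{A}y,x-y\rangle\ge0$ for all $x,y$. $\mathcal{B}$ is monotone if $\langle u-v,x-y\rangle\ge 0$ whenever $u\in\mathcal{B}x$, $v\in\mathcal{B}y$,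 and maximal monotone if its graph is not properly contained in the graph of another monotone operator. *)

theory Defs
  imports "HOL-Analysis.Analysis" "HOL-Library.Landau_Symbols"
begin

text \<open>The dual of a real normed space \<open>'a\<close> is the type \<open>'a \<Rightarrow>\<^sub>L real\<close>, whose norm is the operator
  norm; the pairing is \<open>blinfun_apply\<close>.\<close>

definition canonical_embedding ::
    "'a::real_normed_vector \<Rightarrow> (('a \<Rightarrow>\<^sub>L real) \<Rightarrow>\<^sub>L real)" where
  "canonical_embedding x = Blinfun (\<lambda>f. blinfun_apply f x)"

lemma canonical_embedding_apply: "blinfun_apply (canonical_embedding x) f = blinfun_apply f x"
  unfolding canonical_embedding_def
  by (simp add: bounded_linear_Blinfun_apply bounded_linear_intros)

definition reflexive_space :: "'a::real_normed_vector itself \<Rightarrow> bool" where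
  "reflexive_space _ \<longleftrightarrow>
     surj (canonical_embedding :: 'a \<Rightarrow> (('a \<Rightarrow>\<^sub>L real) \<Rightarrow>\<^sub>L real))"

subsection \<open>Extended-valued functions\<close>

definition effective_domain :: "('a \<Rightarrow> ereal) \<Rightarrow> 'a set" where
  "effective_domain f = {x. f x < \<infinity>}"

definition proper :: "('a \<Rightarrow> ereal) \<Rightarrow> bool" where
  "proper f \<longleftrightarrow> effective_domain f \<noteq> {} \<and> (\<forall>x. f x \<noteq> -\<infinity>)"

definition lower_semicontinuous :: "('a::topological_space \<Rightarrow> ereal) \<Rightarrow> bool" where
  "lower_semicontinuous f \<longleftrightarrow> (\<forall>x c. c < f x \<longrightarrow> (\<forall>\<^sub>F y in nhds x. c < f y))"

definition fenchel_conjugate ::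
    "('a::real_normed_vector \<Rightarrow> ereal) \<Rightarrow> ('a \<Rightarrow>\<^sub>L real) \<Rightarrow> ereal" where
  "fenchel_conjugate f x' = (SUP x. ereal (blinfun_apply x' x) - f x)"

definition has_gateaux_gradient ::
    "('a::real_normed_vector \<Rightarrow> ereal) \<Rightarrow> ('a \<Rightarrow>\<^sub>L real) \<Rightarrow> 'a \<Rightarrow> bool" where
  "has_gateaux_gradient f D x \<longleftrightarrow> \<bar>f x\<bar> \<noteq> \<infinity> \<and>
     (\<forall>y. ((\<lambda>t. (f (x + t *\<^sub>R y) - f x) / ereal t) \<longlongrightarrow> ereal (blinfun_apply D y)) (at 0))"

definition gateaux_differentiable_at ::
    "('a::real_normed_vector \<Rightarrow> ereal) \<Rightarrow> 'a \<Rightarrow> bool" where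
  "gateaux_differentiable_at f x \<longleftrightarrow> (\<exists>D. has_gateaux_gradient f D x)"

definition gateaux_gradient ::
    "('a::real_normed_vector \<Rightarrow> ereal) \<Rightarrow> 'a \<Rightarrow> ('a \<Rightarrow>\<^sub>L real)" where
  "gateaux_gradient f x = (THE D. has_gateaux_gradient f D x)"

definition gradient_domain :: "('a::real_normed_vector \<Rightarrow> ereal) \<Rightarrow> 'a set" where
  "gradient_domain f = {x. gateaux_differentiable_at f x}"

definition legendre :: "('a::real_normed_vector \<Rightarrow> ereal) \<Rightarrow> bool" where
  "legendre f \<longleftrightarrow>
     interior (effective_domain f) \<noteq> {} \<and>
     interior (effective_domain (fenchel_conjugate f)) \<noteq> {} \<and>
     (\<forall>x \<in> interior (effective_domain f). gateaux_differentiable_at f x) \<and>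
     (\<forall>x' \<in> interior (effective_domain (fenchel_conjugate f)).
        gateaux_differentiable_at (fenchel_conjugate f) x') \<and>
     gradient_domain f = interior (effective_domain f) \<and>
     gradient_domain (fenchel_conjugate f) = interior (effective_domain (fenchel_conjugate f))"

subsection \<open>Conditions on a real-valued function\<close>

definition grad :: "('a::real_normed_vector \<Rightarrow> real) \<Rightarrow> 'a \<Rightarrow> ('a \<Rightarrow>\<^sub>L real)" where
  "grad g = gateaux_gradient (\<lambda>x. ereal (g x))"

text \<open>The gradient of the conjugate takes values in the bidual, which is identified with the
  (reflexive) space itself through the canonical embedding.\<close>

definition grad_conjugate :: "('a::real_normed_vector \<Rightarrow> real) \<Rightarrow> ('a \<Rightarrow>\<^sub>L real) \<Rightarrow> 'a" where
  "grad_conjugate g x' =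
     inv canonical_embedding (gateaux_gradient (fenchel_conjugate (\<lambda>x. ereal (g x))) x')"

definition uniformly_frechet_differentiable :: "('a::real_normed_vector \<Rightarrow> real) \<Rightarrow> bool" where
  "uniformly_frechet_differentiable g \<longleftrightarrow>
     (\<forall>x. gateaux_differentiable_at (\<lambda>x. ereal (g x)) x) \<and>
     uniform_limit (UNIV \<times> sphere 0 1)
       (\<lambda>t (x, y). (g (x + t *\<^sub>R y) - g x) / t) (\<lambda>(x, y). blinfun_apply (grad g x) y) (at 0)"

definition strongly_convex :: "real \<Rightarrow> ('a::real_normed_vector \<Rightarrow> real) \<Rightarrow> bool" where
  "strongly_convex \<gamma> g \<longleftrightarrow>
     (\<forall>x y. blinfun_apply (grad g x - grad g y) (x - y) \<ge> \<gamma> * (norm (x - y))\<^sup>2)"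

definition strongly_coercive :: "('a::real_normed_vector \<Rightarrow> real) \<Rightarrow> bool" where
  "strongly_coercive g \<longleftrightarrow> filterlim (\<lambda>x. g x / norm x) at_top at_infinity"

subsection \<open>Monotone operators\<close>

definition monotone_into_dual :: "('a::real_normed_vector \<Rightarrow> ('a \<Rightarrow>\<^sub>L real)) \<Rightarrow> bool" where
  "monotone_into_dual A \<longleftrightarrow> (\<forall>x y. blinfun_apply (A x - A y) (x - y) \<ge> 0)"

definition monotone_operator :: "('a::real_normed_vector \<Rightarrow> ('a \<Rightarrow>\<^sub>L real) set) \<Rightarrow> bool" where
  "monotone_operator B \<longleftrightarrow>
     (\<forall>x y. \<forall>u \<in> B x. \<forall>v \<in> B y. blinfun_apply (u - v) (x - y) \<ge> 0)"

definition operator_graph :: "('a \<Rightarrow> 'b set) \<Rightarrow> ('a \<times> 'b) set" where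
  "operator_graph B = {(x, u). u \<in> B x}"

definition maximal_monotone :: "('a::real_normed_vector \<Rightarrow> ('a \<Rightarrow>\<^sub>L real) set) \<Rightarrow> bool" where
  "maximal_monotone B \<longleftrightarrow> monotone_operator B \<and>
     \<not> (\<exists>C. monotone_operator C \<and> operator_graph B \<subset> operator_graph C)"

definition inverse_operator :: "('a \<Rightarrow> 'b set) \<Rightarrow> 'b \<Rightarrow> 'a set" where
  "inverse_operator T u = {x. u \<in> T x}"

text \<open>The resolvent is the set-valued composition of the inverse relation with the gradient; thus
  \<open>z \<in> resolvent g \<mu> B x\<close> expresses that \<open>z\<close> is the resolvent of \<open>x\<close>.\<close>

definition resolvent ::
    "('a::real_normed_vector \<Rightarrow> real) \<Rightarrow> real \<Rightarrow> ('a \<Rightarrow> ('a \<Rightarrow>\<^sub>L real) set) \<Rightarrow> 'a \<Rightarrow> 'a set" where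
  "resolvent g \<mu> B x =
     inverse_operator (\<lambda>z. (\<lambda>b. grad g z + \<mu> *\<^sub>R b) ` B z) (grad g x)"

end

theory Submission
  imports Defs
begin

text \<open>Each step of the iteration is the inclusion
  \<open>\<nabla>g v\<^sub>n - \<nabla>g v\<^sub>n\<^sub>+\<^sub>1 - \<mu>(2 A v\<^sub>n - A v\<^sub>n\<^sub>-\<^sub>1) \<in> \<mu> B v\<^sub>n\<^sub>+\<^sub>1\<close>. Testing it against a zero \<open>z\<close> of \<open>A + B\<close>, with
  monotonicity of \<open>A\<close> and \<open>B\<close> and the three-point identity of the Bregman distance \<open>D\<close>, shows that
  \<open>T\<^sub>n = D(z, v\<^sub>n) - \<mu>\<langle>A v\<^sub>n - A v\<^sub>n\<^sub>-\<^sub>1, v\<^sub>n - z\<rangle> + \<mu>L/2 \<parallel>v\<^sub>n - v\<^sub>n\<^sub>-\<^sub>1\<parallel>\<^sup>2\<close> satisfies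
  \<open>T\<^sub>n\<^sub>+\<^sub>1 + (\<gamma>/2 - \<mu>L) \<parallel>v\<^sub>n\<^sub>+\<^sub>1 - v\<^sub>n\<parallel>\<^sup>2 \<le> T\<^sub>n\<close>. Since \<open>T\<^sub>n \<ge> 0\<close> by \<open>D(x, y) \<ge> \<gamma>/2 \<parallel>x - y\<parallel>\<^sup>2\<close>, the squared steps are
  summable, which bounds the smallest of the first \<open>n\<close> of them by \<open>O(1/n)\<close>.\<close>

section \<open>Gradients and conjugates\<close>

lemma has_gateaux_gradient_ereal_iff:
  "has_gateaux_gradient (\<lambda>x. ereal (f x)) D x \<longleftrightarrow>
     (\<forall>y. ((\<lambda>t. (f (x + t *\<^sub>R y) - f x) / t) \<longlongrightarrow> blinfun_apply D y) (at 0))"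
proof -
  have "((\<lambda>t. (ereal (f (x + t *\<^sub>R y)) - ereal (f x)) / ereal t) \<longlongrightarrow> ereal (blinfun_apply D y)) (at 0)
      \<longleftrightarrow> ((\<lambda>t. ereal ((f (x + t *\<^sub>R y) - f x) / t)) \<longlongrightarrow> ereal (blinfun_apply D y)) (at 0)" for y
    by (rule tendsto_cong) (auto simp: eventually_at_filter)
  then show ?thesis
    by (simp add: has_gateaux_gradient_def)
qed

lemma has_gateaux_gradient_unique:
  assumes "has_gateaux_gradient f D x" "has_gateaux_gradient f E x"
  shows "D = E"
proof (rule blinfun_eqI)
  fix y
  have "ereal (blinfun_apply D y) = ereal (blinfun_apply E y)"
    using assms[unfolded has_gateaux_gradient_def, THEN conjunct2, rule_format, of y]
    by (rule tendsto_unique[OF trivial_limit_at])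
  then show "blinfun_apply D y = blinfun_apply E y" by simp
qed

lemma has_gateaux_gradient_gateaux_gradient:
  assumes "gateaux_differentiable_at f x"
  shows "has_gateaux_gradient f (gateaux_gradient f x) x"
proof -
  obtain D where D: "has_gateaux_gradient f D x"
    using assms unfolding gateaux_differentiable_at_def by blast
  show ?thesis
    unfolding gateaux_gradient_def
    by (rule theI, rule D) (rule has_gateaux_gradient_unique[OF _ D])
qed

lemma grad_has_real_derivative:
  assumes "gateaux_differentiable_at (\<lambda>x. ereal (g x)) (y + s *\<^sub>R d)"
  shows "((\<lambda>t. g (y + t *\<^sub>R d)) has_real_derivative blinfun_apply (grad g (y + s *\<^sub>R d)) d) (at s)"
proof -
  have "((\<lambda>t. (g (y + s *\<^sub>R d + t *\<^sub>R d) - g (y + s *\<^sub>R d)) / t)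
      \<longlongrightarrow> blinfun_apply (grad g (y + s *\<^sub>R d)) d) (at 0)"
    using has_gateaux_gradient_gateaux_gradient[OF assms]
    unfolding has_gateaux_gradient_ereal_iff grad_def by blast
  then show ?thesis
    by (simp add: DERIV_def algebra_simps)
qed

section \<open>The Bregman distance and its quadratic lower bound\<close>

definition bregman :: "('a::real_normed_vector \<Rightarrow> real) \<Rightarrow> 'a \<Rightarrow> 'a \<Rightarrow> real" where
  "bregman g x y = g x - g y - blinfun_apply (grad g y) (x - y)"

lemma bregman_three_point:
  "blinfun_apply (grad g y - grad g x) (x - z) = bregman g z y - bregman g z x - bregman g x y"
  by (simp add: bregman_def blinfun.bilinear_simps)

text \<open>Strong convexity speaks of gradients only, so it is integrated along the segment from
  \<open>y\<close> to \<open>x\<close>. The function \<open>\<phi>\<close> is \<open>g\<close> minus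
  its tangent part and the quadratic; strong convexity at \<open>y + t d\<close> and
  \<open>y\<close>, divided by \<open>t\<close>, gives a nonnegative derivative.\<close>

lemma bregman_ge:
  assumes diff: "\<And>x. gateaux_differentiable_at (\<lambda>x. ereal (g x)) x"
    and sc: "strongly_convex \<gamma> g"
  shows "\<gamma> / 2 * (norm (x - y))\<^sup>2 \<le> bregman g x y"
proof -
  define d where "d = x - y"
  define \<phi> where "\<phi> t = g (y + t *\<^sub>R d) - t * blinfun_apply (grad g y) d - \<gamma> / 2 * t\<^sup>2 * (norm d)\<^sup>2" for t
  have "\<phi> 0 \<le> \<phi> 1"
  proof (rule DERIV_nonneg_imp_nondecreasing[of 0 1 \<phi>])
    fix t :: real
    assume t: "0 \<le> t" "t \<le> 1"
    let ?D = "blinfun_apply (grad g (y + t *\<^sub>R d)) d - blinfun_apply (grad g y) d - \<gamma> * t * (norm d)\<^sup>2"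
    have "(\<phi> has_real_derivative ?D) (at t)"
      unfolding \<phi>_def
      by (auto intro!: derivative_eq_intros grad_has_real_derivative diff)
    moreover have "0 \<le> ?D"
    proof (cases "t = 0")
      case False
      have "\<gamma> * (norm (t *\<^sub>R d))\<^sup>2 \<le> t * blinfun_apply (grad g (y + t *\<^sub>R d) - grad g y) d"
        using sc[unfolded strongly_convex_def, rule_format, of "y + t *\<^sub>R d" y]
        by (simp add: blinfun.scaleR_right)
      then have "t * (\<gamma> * t * (norm d)\<^sup>2) \<le> t * blinfun_apply (grad g (y + t *\<^sub>R d) - grad g y) d"
        by (simp add: power2_eq_square algebra_simps)
      then show ?thesis
        using False t by (simp add: blinfun.diff_left)
    qed simp
    ultimately show "\<exists>D. (\<phi> has_real_derivative D) (at t) \<and> 0 \<le> D" by blast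
  qed simp
  then show ?thesis
    by (simp add: \<phi>_def d_def bregman_def)
qed

section \<open>The conjugate and the inversion of the gradient\<close>

lemma fenchel_young:
  "ereal (blinfun_apply x' x) - f x \<le> fenchel_conjugate f x'"
  unfolding fenchel_conjugate_def by (rule SUP_upper) simp

text \<open>The quadratic growth of \<open>g\<close> around 0 dominates every linear functional.
  This makes the effective domain of the conjugate the whole dual, so the Legendre property yields a
  gradient at every \<open>x'\<close>.\<close>

lemma fenchel_conjugate_finite:
  assumes diff: "\<And>x. gateaux_differentiable_at (\<lambda>x. ereal (g x)) x"
    and sc: "strongly_convex \<gamma> g" and "\<gamma> > 0"
  shows "\<bar>fenchel_conjugate (\<lambda>x. ereal (g x)) x'\<bar> \<noteq> \<infinity>"
proof -
  define p where "p = grad g 0"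
  \<comment> \<open>The maximum of \<open>s * r - \<gamma> / 2 * r^2\<close> over real
    \<open>r\<close>, with \<open>s = norm (x' - p)\<close>, minus \<open>g 0\<close>.\<close>
  define c where "c = (norm (x' - p))\<^sup>2 / (2 * \<gamma>) - g 0"
  have "blinfun_apply x' x - g x \<le> c" for x
  proof -
    have "\<gamma> / 2 * (norm x)\<^sup>2 \<le> g x - g 0 - blinfun_apply p x"
      using bregman_ge[OF diff sc, of x 0] by (simp add: bregman_def p_def)
    moreover have "blinfun_apply (x' - p) x \<le> norm (x' - p) * norm x"
      using norm_blinfun[of "x' - p" x] by simp
    moreover have "norm (x' - p) * norm x \<le> (norm (x' - p))\<^sup>2 / (2 * \<gamma>) + \<gamma> / 2 * (norm x)\<^sup>2"
    proof -
      have "0 \<le> (norm (x' - p) - \<gamma> * norm x)\<^sup>2 / (2 * \<gamma>)"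
        using \<open>\<gamma> > 0\<close> by simp
      also have "\<dots> = (norm (x' - p))\<^sup>2 / (2 * \<gamma>) + \<gamma> / 2 * (norm x)\<^sup>2 - norm (x' - p) * norm x"
        using \<open>\<gamma> > 0\<close> by (simp add: power2_eq_square field_simps)
      finally show ?thesis by simp
    qed
    ultimately show ?thesis
      by (simp add: c_def blinfun.diff_left)
  qed
  then have "fenchel_conjugate (\<lambda>x. ereal (g x)) x' \<le> ereal c"
    unfolding fenchel_conjugate_def by (intro SUP_least) simp
  moreover have "ereal (blinfun_apply x' 0 - g 0) \<le> fenchel_conjugate (\<lambda>x. ereal (g x)) x'"
    using fenchel_young[of x' 0 "\<lambda>x. ereal (g x)"] by simp
  ultimately show ?thesis by auto
qed

text \<open>No weak compactness is needed: if the gradient of the conjugate at \<open>x'\<close> is evaluation at \<open>x\<close>,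
  the subgradient inequality of the conjugate at \<open>\<nabla>g x\<close> forces \<open>x\<close> to maximise \<open>x' - g\<close>.\<close>

lemma grad_grad_conjugate:
  fixes g :: "'a::real_normed_vector \<Rightarrow> real"
  assumes refl: "reflexive_space TYPE('a)"
    and diff: "\<And>x. gateaux_differentiable_at (\<lambda>x. ereal (g x)) x"
    and sc: "strongly_convex \<gamma> g" and "\<gamma> > 0"
    and leg: "legendre (\<lambda>x. ereal (g x))"
  shows "grad g (grad_conjugate g x') = x'"
proof -
  define h where "h y = real_of_ereal (fenchel_conjugate (\<lambda>x. ereal (g x)) y)" for y
  have h: "fenchel_conjugate (\<lambda>x. ereal (g x)) y = ereal (h y)" for y
    using fenchel_conjugate_finite[OF diff sc \<open>\<gamma> > 0\<close>] by (simp add: h_def ereal_real')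
  have young: "blinfun_apply y x - g x \<le> h y" for y x
    using fenchel_young[of y x "\<lambda>x. ereal (g x)"] by (simp add: h)
  have h_le: "h y \<le> c" if "\<And>x. blinfun_apply y x - g x \<le> c" for y c
  proof -
    have "fenchel_conjugate (\<lambda>x. ereal (g x)) y \<le> ereal c"
      unfolding fenchel_conjugate_def using that by (intro SUP_least) simp
    then show ?thesis by (simp add: h)
  qed
  define D where "D = gateaux_gradient (fenchel_conjugate (\<lambda>x. ereal (g x))) x'"
  define x where "x = grad_conjugate g x'"
  define p where "p = grad g x"
  have D_apply: "blinfun_apply D y = blinfun_apply y x" for y
  proof -
    have "canonical_embedding x = D"
      unfolding x_def grad_conjugate_def D_def
      using refl unfolding reflexive_space_def by (rule surj_f_inv_f)
    then show ?thesis
      by (metis canonical_embedding_apply)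
  qed
  have "gateaux_differentiable_at (fenchel_conjugate (\<lambda>x. ereal (g x))) x'"
    using leg unfolding legendre_def by (simp add: effective_domain_def h)
  then have "has_gateaux_gradient (\<lambda>y. ereal (h y)) D x'"
    using has_gateaux_gradient_gateaux_gradient unfolding D_def h[symmetric] by blast
  then have "((\<lambda>t. (h (x' + t *\<^sub>R (p - x')) - h x') / t) \<longlongrightarrow> blinfun_apply D (p - x')) (at 0)"
    unfolding has_gateaux_gradient_ereal_iff by blast
  then have lim: "((\<lambda>t. (h (x' + t *\<^sub>R (p - x')) - h x') / t) \<longlongrightarrow> blinfun_apply D (p - x')) (at_right 0)"
    by (rule filterlim_mono) (auto simp: at_le)
  \<comment> \<open>By convexity of the conjugate, its difference quotient towards \<open>p\<close>
    is at most the chord slope; dividing by \<open>t\<close> requires the one-sided limit.\<close>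
  have "(h (x' + t *\<^sub>R (p - x')) - h x') / t \<le> h p - h x'" if t: "0 < t" "t < 1" for t
  proof -
    have "h (x' + t *\<^sub>R (p - x')) \<le> (1 - t) * h x' + t * h p"
    proof (rule h_le)
      fix w
      have "(1 - t) * (blinfun_apply x' w - g w) + t * (blinfun_apply p w - g w)
          \<le> (1 - t) * h x' + t * h p"
        using t by (intro add_mono mult_left_mono young) auto
      then show "blinfun_apply (x' + t *\<^sub>R (p - x')) w - g w \<le> (1 - t) * h x' + t * h p"
        by (simp add: blinfun.bilinear_simps algebra_simps)
    qed
    then show ?thesis
      using t by (simp add: field_simps)
  qed
  then have "\<forall>\<^sub>F t in at_right 0. (h (x' + t *\<^sub>R (p - x')) - h x') / t \<le> h p - h x'"
    unfolding eventually_at_right_field by (intro exI[of _ 1]) auto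
  then have "blinfun_apply D (p - x') \<le> h p - h x'"
    by (intro tendsto_upperbound[OF lim]) auto
  \<comment> \<open>Equality in Fenchel-Young at \<open>p = grad g x\<close>, because Bregman
    distances are nonnegative.\<close>
  moreover have "h p \<le> blinfun_apply p x - g x"
  proof (rule h_le)
    fix w
    have "0 \<le> bregman g w x"
      by (rule order_trans[OF _ bregman_ge[OF diff sc]]) (use \<open>\<gamma> > 0\<close> in simp)
    then show "blinfun_apply p w - g w \<le> blinfun_apply p x - g x"
      by (simp add: bregman_def p_def blinfun.diff_right)
  qed
  \<comment> \<open>The pairing of \<open>p\<close> with \<open>x\<close> cancels between the two
    bounds.\<close>
  ultimately have "h x' \<le> blinfun_apply x' x - g x"
    by (simp add: D_apply blinfun.diff_left)
  then have max: "blinfun_apply x' w - g w \<le> blinfun_apply x' x - g x" for w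
    using young order_trans by blast
  \<comment> \<open>Fermat's rule along each line through the maximiser \<open>x\<close>.\<close>
  have "p = x'"
  proof (rule blinfun_eqI)
    fix y
    define q where "q t = g (x + t *\<^sub>R y) - t * blinfun_apply x' y" for t
    have "(q has_real_derivative blinfun_apply p y - blinfun_apply x' y) (at 0)"
      unfolding q_def
      using grad_has_real_derivative[of g x 0 y, OF diff]
      by (auto intro!: derivative_eq_intros simp: p_def)
    then have "blinfun_apply p y - blinfun_apply x' y = 0"
    proof (rule DERIV_local_min[where d = 1])
      show "\<forall>t. \<bar>0 - t\<bar> < 1 \<longrightarrow> q 0 \<le> q t"
      proof (intro allI impI)
        fix t :: real
        show "q 0 \<le> q t"
          using max[of "x + t *\<^sub>R y"] by (simp add: q_def blinfun.bilinear_simps)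
      qed
    qed simp
    then show "blinfun_apply p y = blinfun_apply x' y" by simp
  qed
  then show ?thesis
    by (simp add: p_def x_def)
qed

section \<open>The iteration\<close>

lemma lipschitz_pairing_bound:
  fixes A :: "'a::real_normed_vector \<Rightarrow> 'a \<Rightarrow>\<^sub>L real"
  assumes "L-lipschitz_on UNIV A"
  shows "\<bar>blinfun_apply (A x - A y) w\<bar> \<le> L / 2 * ((norm (x - y))\<^sup>2 + (norm w)\<^sup>2)"
proof -
  have L: "0 \<le> L" "norm (A x - A y) \<le> L * norm (x - y)"
    using lipschitz_on_nonneg[OF assms] lipschitz_onD[OF assms, of x y] by (auto simp: dist_norm)
  have "\<bar>blinfun_apply (A x - A y) w\<bar> \<le> norm (A x - A y) * norm w"
    using norm_blinfun[of "A x - A y" w] by simp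
  also have "\<dots> \<le> L * norm (x - y) * norm w"
    using L by (intro mult_right_mono) auto
  also have "\<dots> = L / 2 * (2 * norm (x - y) * norm w)"
    by simp
  also have "\<dots> \<le> L / 2 * ((norm (x - y))\<^sup>2 + (norm w)\<^sup>2)"
    using L sum_squares_bound by (intro mult_left_mono) auto
  finally show ?thesis .
qed

text \<open>\<open>x\<close> and \<open>y\<close> are consecutive iterates, the older one first. The
  last term is held in reserve for the Lipschitz error that the next step produces.\<close>

definition lyapunov ::
    "('a::real_normed_vector \<Rightarrow> real) \<Rightarrow> ('a \<Rightarrow> 'a \<Rightarrow>\<^sub>L real) \<Rightarrow> real \<Rightarrow> real \<Rightarrow> 'a \<Rightarrow> 'a \<Rightarrow> 'a \<Rightarrow> real" where
  "lyapunov g A L \<mu> z x y =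
     bregman g z y - \<mu> * blinfun_apply (A y - A x) (y - z) + \<mu> * L / 2 * (norm (y - x))\<^sup>2"

text \<open>The pairing costs at most two squares: the last term of \<open>lyapunov\<close> pays for
  that of \<open>y - x\<close>, the Bregman distance for that of \<open>y - z\<close>.\<close>

lemma lyapunov_nonneg:
  assumes diff: "\<And>x. gateaux_differentiable_at (\<lambda>x. ereal (g x)) x"
    and sc: "strongly_convex \<gamma> g"
    and lip: "L-lipschitz_on UNIV A" and "0 \<le> \<mu>" and "\<mu> * L \<le> \<gamma>"
  shows "0 \<le> lyapunov g A L \<mu> z x y"
proof -
  have "\<mu> * blinfun_apply (A y - A x) (y - z) \<le> \<mu> * (L / 2 * ((norm (y - x))\<^sup>2 + (norm (y - z))\<^sup>2))"
    using abs_le_D1[OF lipschitz_pairing_bound[OF lip]] \<open>0 \<le> \<mu>\<close> by (rule mult_left_mono)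
  moreover have "\<mu> * L / 2 * (norm (y - z))\<^sup>2 \<le> \<gamma> / 2 * (norm (y - z))\<^sup>2"
    using \<open>\<mu> * L \<le> \<gamma>\<close> by (intro mult_right_mono) auto
  ultimately show ?thesis
    using bregman_ge[OF diff sc, of z y]
    by (simp add: lyapunov_def norm_minus_commute algebra_simps)
qed

lemma lyapunov_step:
  assumes diff: "\<And>x. gateaux_differentiable_at (\<lambda>x. ereal (g x)) x"
    and sc: "strongly_convex \<gamma> g"
    and lip: "L-lipschitz_on UNIV A" and "0 \<le> \<mu>"
    and monA: "monotone_into_dual A" and monB: "monotone_operator B"
    and z: "- A z \<in> B z" and u: "u \<in> B x2"
    and step: "grad g x2 + \<mu> *\<^sub>R u = grad g x1 - \<mu> *\<^sub>R (2 *\<^sub>R A x1 - A x0)"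
  shows "lyapunov g A L \<mu> z x1 x2 + (\<gamma> / 2 - \<mu> * L) * (norm (x2 - x1))\<^sup>2 \<le> lyapunov g A L \<mu> z x0 x1"
proof -
  have "0 \<le> \<mu> * blinfun_apply (u - (- A z)) (x2 - z)"
    using monB z u \<open>0 \<le> \<mu>\<close> unfolding monotone_operator_def by (intro mult_nonneg_nonneg) blast+
  also have "\<dots> = blinfun_apply (\<mu> *\<^sub>R u + \<mu> *\<^sub>R A z) (x2 - z)"
    by (simp add: blinfun.bilinear_simps algebra_simps)
  \<comment> \<open>The extrapolation \<open>2 A x1 - A x0\<close> is regrouped so that the error
    \<open>A x2 - A x1\<close> enters the new Lyapunov value and \<open>A x1 - A x0\<close> the old
    one.\<close>
  also have "\<mu> *\<^sub>R u + \<mu> *\<^sub>R A z =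
      grad g x1 - grad g x2 - \<mu> *\<^sub>R (A x2 - A z) + \<mu> *\<^sub>R (A x2 - A x1) - \<mu> *\<^sub>R (A x1 - A x0)"
    using step by (simp add: algebra_simps scaleR_2 eq_diff_eq)
  finally have "0 \<le> blinfun_apply (grad g x1 - grad g x2) (x2 - z)
      - \<mu> * blinfun_apply (A x2 - A z) (x2 - z) + \<mu> * blinfun_apply (A x2 - A x1) (x2 - z)
      - \<mu> * blinfun_apply (A x1 - A x0) (x2 - z)"
    by (simp add: blinfun.add_left blinfun.diff_left blinfun.scaleR_left)
  moreover have "0 \<le> \<mu> * blinfun_apply (A x2 - A z) (x2 - z)"
    using monA \<open>0 \<le> \<mu>\<close> unfolding monotone_into_dual_def by simp
  \<comment> \<open>The first summand belongs to the old Lyapunov value; only the second has to be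
    estimated.\<close>
  moreover have "\<mu> * blinfun_apply (A x1 - A x0) (x2 - z) =
      \<mu> * blinfun_apply (A x1 - A x0) (x1 - z) + \<mu> * blinfun_apply (A x1 - A x0) (x2 - x1)"
    by (simp add: blinfun.diff_right algebra_simps)
  moreover have "\<mu> * - blinfun_apply (A x1 - A x0) (x2 - x1)
      \<le> \<mu> * (L / 2 * ((norm (x1 - x0))\<^sup>2 + (norm (x2 - x1))\<^sup>2))"
    using abs_le_D2[OF lipschitz_pairing_bound[OF lip]] \<open>0 \<le> \<mu>\<close> by (rule mult_left_mono)
  then have "- (\<mu> * blinfun_apply (A x1 - A x0) (x2 - x1))
      \<le> \<mu> * L / 2 * (norm (x1 - x0))\<^sup>2 + \<mu> * L / 2 * (norm (x2 - x1))\<^sup>2"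
    by (simp add: algebra_simps)
  \<comment> \<open>Of the \<open>\<gamma> / 2\<close> gained from the Bregman distance of
    \<open>x2\<close> and \<open>x1\<close>, one \<open>\<mu> * L / 2\<close> covers the estimate
    above, the other the last term of the new Lyapunov value.\<close>
  moreover have "(\<gamma> / 2 - \<mu> * L) * (norm (x2 - x1))\<^sup>2 =
      \<gamma> / 2 * (norm (x2 - x1))\<^sup>2 - \<mu> * L / 2 * (norm (x2 - x1))\<^sup>2 - \<mu> * L / 2 * (norm (x2 - x1))\<^sup>2"
    by (simp add: algebra_simps)
  ultimately show ?thesis
    using bregman_ge[OF diff sc, of x2 x1] bregman_three_point[of g x1 x2 z]
    unfolding lyapunov_def by linarith
qed

section \<open>From bounded sums of squares to the rate\<close>

lemma Min_bigo_inverse_sqrt: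
  fixes a :: "nat \<Rightarrow> real"
  assumes nonneg: "\<And>j. 0 \<le> a j" and sum: "\<And>n. (\<Sum>j = 1..n. (a j)\<^sup>2) \<le> C"
  shows "(\<lambda>n. Min (a ` {1..n})) \<in> O(\<lambda>n. 1 / sqrt (real n))"
proof (rule bigoI[where c = "sqrt C"])
  show "\<forall>\<^sub>F n in sequentially. norm (Min (a ` {1..n})) \<le> sqrt C * norm (1 / sqrt (real n))"
    \<comment> \<open>For \<open>n = 0\<close> the minimum would range over the empty set.\<close>
    using eventually_ge_at_top[of 1]
  proof eventually_elim
    case (elim n)
    define m where "m = Min (a ` {1..n})"
    have "0 \<le> m"
      unfolding m_def using nonneg elim by (subst Min_ge_iff) auto
    have "real n * m\<^sup>2 = (\<Sum>j = 1..n. m\<^sup>2)"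
      by simp
    also have "\<dots> \<le> (\<Sum>j = 1..n. (a j)\<^sup>2)"
      using \<open>0 \<le> m\<close> by (intro sum_mono power_mono) (auto simp: m_def)
    finally have "m\<^sup>2 \<le> C / real n"
      using sum[of n] elim by (simp add: field_simps)
    then have "m \<le> sqrt (C / real n)"
      by (rule real_le_rsqrt)
    then show ?case
      using \<open>0 \<le> m\<close> unfolding m_def[symmetric] by (simp add: real_sqrt_divide)
  qed
qed

theorem theorem4p9:
  fixes g :: "'a::banach \<Rightarrow> real"
    and A :: "'a \<Rightarrow> ('a \<Rightarrow>\<^sub>L real)"
    and B :: "'a \<Rightarrow> ('a \<Rightarrow>\<^sub>L real) set"
    and v :: "nat \<Rightarrow> 'a"
    and \<gamma> L \<delta> \<mu> :: real
  assumes "reflexive_space TYPE('a)"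
    and "proper (\<lambda>x. ereal (g x))"
    and "convex_on UNIV g"
    and "lower_semicontinuous (\<lambda>x. ereal (g x))"
    and "uniformly_frechet_differentiable g"
    and "\<gamma> > 0" and "strongly_convex \<gamma> g"
    and "strongly_coercive g"
    and "legendre (\<lambda>x. ereal (g x))"
    and "monotone_into_dual A"
    and "L > 0" and "L-lipschitz_on UNIV A"
    and "maximal_monotone B"
    and "inverse_operator (\<lambda>x. (+) (A x) ` B x) 0 \<noteq> {}"
    and "\<delta> \<in> {0<..<1/2}"
    and "\<mu> \<in> {\<delta> .. \<gamma> * (1 - 2 * \<delta>) / (2 * L)}"
    and "\<And>n. n \<ge> 1 \<Longrightarrow>
      v (n + 1) \<in> resolvent g \<mu> B
        (grad_conjugate g (grad g (v n) - \<mu> *\<^sub>R (2 *\<^sub>R A (v n) - A (v (n - 1)))))"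
  shows "(\<lambda>n. Min ((\<lambda>j. norm (v (j + 1) - v j)) ` {1..n})) \<in> O(\<lambda>n. 1 / sqrt (real n))"
proof -
  note unif = assms(5) and \<gamma> = assms(6) and sc = assms(7) and lip = assms(12)
  have diff: "gateaux_differentiable_at (\<lambda>x. ereal (g x)) x" for x
    using unif unfolding uniformly_frechet_differentiable_def by blast
  have monB: "monotone_operator B"
    using assms(13) by (simp add: maximal_monotone_def)
  obtain z b where "b \<in> B z" "0 = A z + b"
    using assms(14) by (auto simp: inverse_operator_def)
  then have z: "- A z \<in> B z"
    using minus_unique by metis
  \<comment> \<open>The upper bound on \<open>\<mu>\<close> says
    \<open>\<mu> * L \<le> \<gamma> / 2 - \<gamma> * \<delta>\<close>, so each step gains at least
    \<open>\<gamma> * \<delta>\<close> times its square.\<close>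
  have \<mu>: "0 \<le> \<mu>" and \<mu>L: "\<gamma> * \<delta> \<le> \<gamma> / 2 - \<mu> * L"
    using assms(11,15,16) by (auto simp: field_simps)
  have "0 < \<gamma> * \<delta>"
    using \<gamma> assms(15) by simp
  \<comment> \<open>At \<open>n = 0\<close> truncated subtraction makes both iterates
    \<open>v 0\<close>; the telescoping starts at \<open>T 1\<close>, which involves
    \<open>v 0\<close> and \<open>v 1\<close>.\<close>
  define T where "T n = lyapunov g A L \<mu> z (v (n - 1)) (v n)" for n
  have T_nonneg: "0 \<le> T n" for n
    unfolding T_def
    by (rule lyapunov_nonneg[OF diff sc lip \<mu>]) (use \<mu>L \<gamma> \<open>0 < \<gamma> * \<delta>\<close> in linarith)
  have T_step: "\<gamma> * \<delta> * (norm (v (n + 1) - v n))\<^sup>2 \<le> T n - T (n + 1)" if n: "n \<ge> 1" for n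
  proof -
    \<comment> \<open>Since \<open>grad g\<close> undoes \<open>grad_conjugate g\<close>, resolvent
      membership becomes an explicit equation for some \<open>u\<close> in
      \<open>B (v (n + 1))\<close>.\<close>
    obtain u where "u \<in> B (v (n + 1))"
      "grad g (v (n + 1)) + \<mu> *\<^sub>R u = grad g (v n) - \<mu> *\<^sub>R (2 *\<^sub>R A (v n) - A (v (n - 1)))"
      using assms(17)[OF n]
      by (auto simp: resolvent_def inverse_operator_def
          grad_grad_conjugate[OF assms(1) diff sc \<gamma> assms(9)])
    from lyapunov_step[OF diff sc lip \<mu> assms(10) monB z this]
    have "T (n + 1) + (\<gamma> / 2 - \<mu> * L) * (norm (v (n + 1) - v n))\<^sup>2 \<le> T n"
      by (simp add: T_def)
    moreover have "\<gamma> * \<delta> * (norm (v (n + 1) - v n))\<^sup>2 \<le> (\<gamma> / 2 - \<mu> * L) * (norm (v (n + 1) - v n))\<^sup>2"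
      using \<mu>L by (intro mult_right_mono) auto
    ultimately show ?thesis by linarith
  qed
  have "\<gamma> * \<delta> * (\<Sum>j = 1..n. (norm (v (j + 1) - v j))\<^sup>2) \<le> T 1 - T (n + 1)" for n
  proof (induction n)
    case (Suc n)
    then show ?case
      using T_step[of "Suc n"] by (simp add: distrib_left)
  qed simp
  then have "\<gamma> * \<delta> * (\<Sum>j = 1..n. (norm (v (j + 1) - v j))\<^sup>2) \<le> T 1" for n
    by (rule order_trans) (simp add: T_nonneg)
  then have "(\<Sum>j = 1..n. (norm (v (j + 1) - v j))\<^sup>2) \<le> T 1 / (\<gamma> * \<delta>)" for n
    using \<open>0 < \<gamma> * \<delta>\<close> by (simp add: pos_le_divide_eq mult.commute)
  then show ?thesis
    by (intro Min_bigo_inverse_sqrt) auto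
qed

end
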